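(* Let $\Gamma$ be a surface context and let $\{c_i\,\overline{a_i}\to t_i\}_{i=1..n}$ be a (pure) case tree for a datatype declared in $\Gamma$ with constructors $c_1,\dots,c_n$. The elaborations of $\mu$- and $\mu'$-expressions and the elaborations of the terms to which they single-step are joinable: (1) If $\Gamma\vdash\mu\,ih.\,(c_j\,\overline s)\,\{c_i\,\overline{a_i}\to t_i\}_{i=1..n}\hookrightarrow e_1$, and $\mu\,ih.\,(c_j\,\overline s)\,\{c_i\,\overline{a_i}\to t_i\}_{i=1..n}\rightsquigarrow t$ (by the $\mu$-reduction rule), and $\Gamma\vdash t\hookrightarrow e_2$, then there exists $e_3$ such that $e_1\rightsquigarrow^*e_3$ and $e_2\rightsquigarrow^*e_3$. (2) If $\Gamma\vdash\mu'\,(c_j\,\overline s)\,\{c_i\,\overline{a_i}\to t_i\}_{i=1..n}\hookrightarrow e_1$, and $\mu'\,(c_j\,\overline s)\,\{c_i\,\overline{a_i}\to t_i\}_{i=1..n}\rightsquigarrow t$ (by the $\mu'$-reduction rule), and $\Gamma\vdash t\hookrightarrow e_2$, then there exists $e_3$ such that $e_1\rightsquigarrow^*e_3$ and $e_2\rightsquigarrow^*e_3$.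
   Context: **Pure surface terms.** These are the untyped terms obtained from Cedille's annotated surface terms by erasing all types, erased arguments and annotations: $t::=x\mid\lambda x.t\mid t\,t'\mid c\mid \mathtt{is/}D\mid\mathtt{to/}D\mid\mu\,ih.\,t\,\{c_i\,\overline{a_i}\to t_i\}_{i=1..n}\mid\mu'\,t\,\{c_i\,\overline{a_i}\to t_i\}_{i=1..n}$. Here $\Gamma$ contains declared datatypes $D$; each has constructors $c_1,\dots,c_n$ in a fixed order, $c_i$ taking $k_i\ge0$ unerased arguments. A case tree for $D$ has exactly one branch for each constructor of $D$, in order, and its $i$-th pattern binds $k_i$ variables $\overline{a_i}$ in $t_i$; in $\mu$-expressions $ih$ is moreover bound in all branches ($\mu\,ih.$ denotes recursion, $\mu'$ plain case analysis). **Surface reduction** of $\mu$ and $\mu'$, for $1\le j\le n$ and $\#\overline s=\#\overline{a_j}$: $$\mu'\,(c_j\,\overline s)\,\{c_i\,\overline{a_i}\to t_i\}_{i=1..n}\rightsquigarrow[\overline{s/a_j}]\,t_j,\qquad \mu\,ih.\,(c_j\,\overline s)\,\{c_i\,\overline{a_i}\to t_i\}_{i=1..n}\rightsquigarrow[\overline{s/a_j}][r/ih]\,t_j,$$ with $r=\lambda x.\,\mu\,ih.\,x\,\{c_i\,\overline{a_i}\to t_i\}_{i=1..n}$. **Target.** The untyped $\lambda$-calculus; $\rightsquigarrow$ is its (full) $\beta\eta$-reduction and $\rightsquigarrow^*$ the reflexive-transitive closure. There are fixed closed $\lambda$-terms $\mathtt{in}$, $\mathtt{out}$, $\mathtt{induction}$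 (erasures of a generic library of $\lambda$-encodings), satisfying: - (Requirement 1) $\mathtt{in}$ and $\mathtt{out}$ are mutual inverses, and $\mathtt{out}\,(\mathtt{in}\,xs)$ $\beta$-reduces to $xs$, within a constant number of steps; - (Requirement 2) for every untyped $\lambda$-term $a$ there exists a term $t$ such that $\mathtt{induction}\,a\rightsquigarrow^*t$ and, for all terms $xs$, $\mathtt{induction}\,a\,(\mathtt{in}\,xs)\rightsquigarrow^*a\,\mathtt{out}\,t\,xs$. From these one has closed $\lambda$-terms $|\mathtt{mu}|=\lambda x.\lambda f.\,\mathtt{induction}\,(\lambda o.\lambda ih.\lambda xs.\,f\,ih\,xs)\,x$ and $|\mathtt{mu'}|=\lambda x.\lambda f.\,f\,(\mathtt{out}\,x)$. **Elaboration of pure terms** $\Gamma\vdash t\hookrightarrow p$ is homomorphic on variables, abstractions and applications, and moreover: - a constructor $c_j$ elaborates to the erasure of its $\lambda$-encoding, $\lambda\overline{a_j}.\,\mathtt{in}\,\big((\lambda\overline{a_j}.\,(\lambda\overline{a_j}.\,\lambda x_1\dots x_n.\,x_j\,\overline{a_j})\,\overline{a_j})\,\overline{a_j}\big)$, where $\overline{a_j}$ is a list of $k_j$ variables; - $\mathtt{is/}D$ and $\mathtt{to/}D$ elaborate to fixed closed $\lambda$-terms, that for $\mathtt{to/}D$ being $\beta\eta$-equal to $\lambda x.x$; - if $\Gamma\vdash t\hookrightarrow t'$ and $\Gamma\vdash t_i\hookrightarrow t_i'$ for $i=1..n$, then $\Gamma\vdash\mu\,ih.\,t\,\{c_i\,\overline{a_i}\to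 t_i\}_{i=1..n}\hookrightarrow|\mathtt{mu}|\,t'\,(\lambda ih.\lambda x.\,x\,(\lambda\overline{a_1}.t_1')\cdots(\lambda\overline{a_n}.t_n'))$ and $\Gamma\vdash\mu'\,t\,\{c_i\,\overline{a_i}\to t_i\}_{i=1..n}\hookrightarrow|\mathtt{mu'}|\,t'\,(\lambda x.\,x\,(\lambda\overline{a_1}.t_1')\cdots(\lambda\overline{a_n}.t_n'))$. *)

theory Defs
  imports Main
begin

text \<open>
  Both calculi are represented with de Bruijn indices, so terms are identified up to renaming of
  bound variables. Substitutions are simultaneous: \<open>sub \<sigma> t\<close> replaces every free index
  \<open>i\<close> of \<open>t\<close> by \<open>\<sigma> i\<close>.
\<close>

section \<open>The untyped lambda-calculus\<close>

datatype lam = Var nat | App lam lam (infixl \<open>\<cdot>\<close> 100) | Lam lam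

definition up_ren :: "nat \<Rightarrow> (nat \<Rightarrow> nat) \<Rightarrow> nat \<Rightarrow> nat" where
  "up_ren n \<xi> i = (if i < n then i else \<xi> (i - n) + n)"

primrec ren :: "(nat \<Rightarrow> nat) \<Rightarrow> lam \<Rightarrow> lam" where
  "ren \<xi> (Var i) = Var (\<xi> i)"
| "ren \<xi> (s \<cdot> t) = ren \<xi> s \<cdot> ren \<xi> t"
| "ren \<xi> (Lam t) = Lam (ren (up_ren 1 \<xi>) t)"

definition up :: "nat \<Rightarrow> (nat \<Rightarrow> lam) \<Rightarrow> nat \<Rightarrow> lam" where
  "up n \<sigma> i = (if i < n then Var i else ren (\<lambda>x. x + n) (\<sigma> (i - n)))"

primrec sub :: "(nat \<Rightarrow> lam) \<Rightarrow> lam \<Rightarrow> lam" where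
  "sub \<sigma> (Var i) = \<sigma> i"
| "sub \<sigma> (s \<cdot> t) = sub \<sigma> s \<cdot> sub \<sigma> t"
| "sub \<sigma> (Lam t) = Lam (sub (up 1 \<sigma>) t)"

primrec fv :: "lam \<Rightarrow> nat set" where
  "fv (Var i) = {i}"
| "fv (s \<cdot> t) = fv s \<union> fv t"
| "fv (Lam t) = {i. Suc i \<in> fv t}"

definition closed :: "lam \<Rightarrow> bool" where
  "closed t \<longleftrightarrow> fv t = {}"

inductive beta :: "lam \<Rightarrow> lam \<Rightarrow> bool" (infix \<open>\<rightarrow>\<^sub>\<beta>\<close> 50) where
  beta: "Lam s \<cdot> t \<rightarrow>\<^sub>\<beta> sub (case_nat t Var) s"
| beta_appL: "s \<rightarrow>\<^sub>\<beta> s' \<Longrightarrow> s \<cdot> t \<rightarrow>\<^sub>\<beta> s' \<cdot> t"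
| beta_appR: "t \<rightarrow>\<^sub>\<beta> t' \<Longrightarrow> s \<cdot> t \<rightarrow>\<^sub>\<beta> s \<cdot> t'"
| beta_lam: "t \<rightarrow>\<^sub>\<beta> t' \<Longrightarrow> Lam t \<rightarrow>\<^sub>\<beta> Lam t'"

inductive betaeta :: "lam \<Rightarrow> lam \<Rightarrow> bool" (infix \<open>\<leadsto>\<close> 50) where
  betaeta_beta: "Lam s \<cdot> t \<leadsto> sub (case_nat t Var) s"
| betaeta_eta: "Lam (ren Suc s \<cdot> Var 0) \<leadsto> s"
| betaeta_appL: "s \<leadsto> s' \<Longrightarrow> s \<cdot> t \<leadsto> s' \<cdot> t"
| betaeta_appR: "t \<leadsto> t' \<Longrightarrow> s \<cdot> t \<leadsto> s \<cdot> t'"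
| betaeta_lam: "t \<leadsto> t' \<Longrightarrow> Lam t \<leadsto> Lam t'"

abbreviation betaetas :: "lam \<Rightarrow> lam \<Rightarrow> bool" (infix \<open>\<leadsto>\<^sup>*\<close> 50) where
  "s \<leadsto>\<^sup>* t \<equiv> betaeta\<^sup>*\<^sup>* s t"

abbreviation betaeta_eq :: "lam \<Rightarrow> lam \<Rightarrow> bool" (infix \<open>=\<^sub>\<beta>\<^sub>\<eta>\<close> 50) where
  "s =\<^sub>\<beta>\<^sub>\<eta> t \<equiv> equivclp betaeta s t"

definition lams :: "nat \<Rightarrow> lam \<Rightarrow> lam" where
  "lams n t = (Lam ^^ n) t"

definition apps :: "lam \<Rightarrow> lam list \<Rightarrow> lam" where
  "apps t us = foldl App t us"


section \<open>Pure surface terms\<close>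

text \<open>
  Datatype names have type \<open>'d\<close> and constructor names type \<open>'c\<close>.
  \<open>Branch c k t\<close> is the branch for the pattern \<open>c a\<^sub>1 \<dots> a\<^sub>k\<close>: its body \<open>t\<close>
  lies under \<open>k\<close> binders, of which \<open>a\<^sub>k\<close> is the innermost (index \<open>0\<close>) and
  \<open>a\<^sub>1\<close> the outermost (index \<open>k - 1\<close>). In \<open>SMu t bs\<close> (the \<open>\<mu>\<close>-expression) the
  variable \<open>ih\<close> is bound outside the pattern variables, so it is index \<open>k\<close> in such a
  body; it is not bound in the scrutinee \<open>t\<close>. \<open>SCase\<close> is the \<open>\<mu>'\<close>-expression.
\<close>

datatype ('c, 't) branch = Branch (ctor: 'c) (arity: nat) (body: 't)

datatype ('d, 'c) sterm =
    SVar nat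
  | SLam "('d, 'c) sterm"
  | SApp "('d, 'c) sterm" "('d, 'c) sterm"
  | SCon 'c
  | SIs 'd
  | STo 'd
  | SMu "('d, 'c) sterm" "('c, ('d, 'c) sterm) branch list"
  | SCase "('d, 'c) sterm" "('c, ('d, 'c) sterm) branch list"

type_synonym ('d, 'c) case_tree = "('c, ('d, 'c) sterm) branch list"

lemma size_body_less [termination_simp]:
  "b \<in> set bs \<Longrightarrow>
    size (body b) < Suc (size_list (size_branch (\<lambda>_. 0) size) bs + size t)"
proof (induction bs)
  case (Cons a bs)
  then show ?case by (cases a) auto
qed simp

fun sren :: "(nat \<Rightarrow> nat) \<Rightarrow> ('d, 'c) sterm \<Rightarrow> ('d, 'c) sterm" where
  "sren \<xi> (SVar i) = SVar (\<xi> i)"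
| "sren \<xi> (SLam t) = SLam (sren (up_ren 1 \<xi>) t)"
| "sren \<xi> (SApp s t) = SApp (sren \<xi> s) (sren \<xi> t)"
| "sren \<xi> (SCon c) = SCon c"
| "sren \<xi> (SIs d) = SIs d"
| "sren \<xi> (STo d) = STo d"
| "sren \<xi> (SMu t bs) = SMu (sren \<xi> t)
     (map (\<lambda>b. Branch (ctor b) (arity b) (sren (up_ren (Suc (arity b)) \<xi>) (body b))) bs)"
| "sren \<xi> (SCase t bs) = SCase (sren \<xi> t)
     (map (\<lambda>b. Branch (ctor b) (arity b) (sren (up_ren (arity b) \<xi>) (body b))) bs)"

definition sup_sub :: "nat \<Rightarrow> (nat \<Rightarrow> ('d, 'c) sterm) \<Rightarrow> nat \<Rightarrow> ('d, 'c) sterm" where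
  "sup_sub n \<sigma> i = (if i < n then SVar i else sren (\<lambda>x. x + n) (\<sigma> (i - n)))"

fun ssub :: "(nat \<Rightarrow> ('d, 'c) sterm) \<Rightarrow> ('d, 'c) sterm \<Rightarrow> ('d, 'c) sterm" where
  "ssub \<sigma> (SVar i) = \<sigma> i"
| "ssub \<sigma> (SLam t) = SLam (ssub (sup_sub 1 \<sigma>) t)"
| "ssub \<sigma> (SApp s t) = SApp (ssub \<sigma> s) (ssub \<sigma> t)"
| "ssub \<sigma> (SCon c) = SCon c"
| "ssub \<sigma> (SIs d) = SIs d"
| "ssub \<sigma> (STo d) = STo d"
| "ssub \<sigma> (SMu t bs) = SMu (ssub \<sigma> t)
     (map (\<lambda>b. Branch (ctor b) (arity b) (ssub (sup_sub (Suc (arity b)) \<sigma>) (body b))) bs)"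
| "ssub \<sigma> (SCase t bs) = SCase (ssub \<sigma> t)
     (map (\<lambda>b. Branch (ctor b) (arity b) (ssub (sup_sub (arity b) \<sigma>) (body b))) bs)"

text \<open>
  \<open>inst us\<close> simultaneously instantiates the \<open>length us\<close> innermost binders with the
  terms \<open>us\<close>, listed from the outermost binder to the innermost one.
\<close>

definition inst :: "('d, 'c) sterm list \<Rightarrow> nat \<Rightarrow> ('d, 'c) sterm" where
  "inst us i = (if i < length us then rev us ! i else SVar (i - length us))"

definition sapps :: "('d, 'c) sterm \<Rightarrow> ('d, 'c) sterm list \<Rightarrow> ('d, 'c) sterm" where
  "sapps t us = foldl SApp t us"

text \<open>The term \<open>r = \<lambda>x. \<mu> ih. x {c\<^sub>i a\<^sub>i \<rightarrow> t\<^sub>i}\<close>; the bodies are shifted past the new binder \<open>x\<close>.\<close>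

definition rec_fun :: "('d, 'c) case_tree \<Rightarrow> ('d, 'c) sterm" where
  "rec_fun bs = SLam (SMu (SVar 0)
     (map (\<lambda>b. Branch (ctor b) (arity b) (sren (up_ren (Suc (arity b)) Suc) (body b))) bs))"

text \<open>
  The reduction rules themselves, without congruence closure. In the \<open>\<mu>\<close>-rule the two
  substitutions are performed at once: \<open>ih\<close> is the binder just outside the pattern variables,
  and neither it nor the pattern variables can occur free in \<open>ss\<close> or \<open>rec_fun bs\<close>.
\<close>

inductive mu_step :: "('d, 'c) sterm \<Rightarrow> ('d, 'c) sterm \<Rightarrow> bool" where
  "j < length bs \<Longrightarrow> length ss = arity (bs ! j) \<Longrightarrow>
     mu_step (SMu (sapps (SCon (ctor (bs ! j))) ss) bs)
             (ssub (inst (rec_fun bs # ss)) (body (bs ! j)))"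

inductive case_step :: "('d, 'c) sterm \<Rightarrow> ('d, 'c) sterm \<Rightarrow> bool" where
  "j < length bs \<Longrightarrow> length ss = arity (bs ! j) \<Longrightarrow>
     case_step (SCase (sapps (SCon (ctor (bs ! j))) ss) bs)
               (ssub (inst ss) (body (bs ! j)))"


section \<open>Surface contexts\<close>

text \<open>
  Of a surface context only the datatype declarations matter for the elaboration of pure terms:
  each datatype comes with the ordered list of its constructors and their numbers of unerased
  arguments. Names are declared at most once.
\<close>

type_synonym ('d, 'c) sctx = "('d \<times> ('c \<times> nat) list) list"

definition surface_context :: "('d, 'c) sctx \<Rightarrow> bool" where
  "surface_context \<Gamma> \<longleftrightarrow>
     distinct (map fst \<Gamma>) \<and> distinct (concat (map (\<lambda>(d, cs). map fst cs) \<Gamma>))"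

definition case_tree_for :: "('d, 'c) sctx \<Rightarrow> 'd \<Rightarrow> ('d, 'c) case_tree \<Rightarrow> bool" where
  "case_tree_for \<Gamma> d bs \<longleftrightarrow> (d, map (\<lambda>b. (ctor b, arity b)) bs) \<in> set \<Gamma>"


section \<open>The library of lambda-encodings\<close>

record 'd library =
  In :: lam
  Out :: lam
  Induction :: lam
  is_elab :: "'d \<Rightarrow> lam"
  to_elab :: "'d \<Rightarrow> lam"

text \<open>
  \<open>In\<close> and \<open>Out\<close> are inverse to each other as maps between arbitrary terms and the data they
  encode, i.e. the terms convertible to some \<open>In \<cdot> xs\<close>. The restriction matters for
  \<open>In \<cdot> (Out \<cdot> x)\<close>: for typed \<open>x\<close> its equality with \<open>x\<close> is proved by induction, and it is
  not in general a conversion of untyped terms when \<open>x\<close> is, say, a variable. It only weakens the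
  hypothesis.
\<close>

definition requirement1 :: "'d library \<Rightarrow> bool" where
  "requirement1 L \<longleftrightarrow>
     (\<forall>xs. Out L \<cdot> (In L \<cdot> xs) =\<^sub>\<beta>\<^sub>\<eta> xs) \<and>
     (\<forall>x. (\<exists>xs. x =\<^sub>\<beta>\<^sub>\<eta> In L \<cdot> xs) \<longrightarrow> In L \<cdot> (Out L \<cdot> x) =\<^sub>\<beta>\<^sub>\<eta> x) \<and>
     (\<exists>N. \<forall>xs. \<exists>m\<le>N. (beta ^^ m) (Out L \<cdot> (In L \<cdot> xs)) xs)"

definition requirement2 :: "'d library \<Rightarrow> bool" where
  "requirement2 L \<longleftrightarrow>
     (\<forall>a. \<exists>t. Induction L \<cdot> a \<leadsto>\<^sup>* t \<and>
        (\<forall>xs. Induction L \<cdot> a \<cdot> (In L \<cdot> xs) \<leadsto>\<^sup>* a \<cdot> Out L \<cdot> t \<cdot> xs))"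

definition encoding_library :: "'d library \<Rightarrow> bool" where
  "encoding_library L \<longleftrightarrow>
     closed (In L) \<and> closed (Out L) \<and> closed (Induction L) \<and>
     (\<forall>d. closed (is_elab L d)) \<and>
     (\<forall>d. closed (to_elab L d) \<and> to_elab L d =\<^sub>\<beta>\<^sub>\<eta> Lam (Var 0)) \<and>
     requirement1 L \<and> requirement2 L"

text \<open>\<open>\<lambda>x. \<lambda>f. induction (\<lambda>o. \<lambda>ih. \<lambda>xs. f ih xs) x\<close> and \<open>\<lambda>x. \<lambda>f. f (out x)\<close>\<close>

definition mu_tm :: "'d library \<Rightarrow> lam" where
  "mu_tm L = Lam (Lam (Induction L \<cdot> Lam (Lam (Lam (Var 3 \<cdot> Var 1 \<cdot> Var 0))) \<cdot> Var 1))"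

definition case_tm :: "'d library \<Rightarrow> lam" where
  "case_tm L = Lam (Lam (Var 0 \<cdot> (Out L \<cdot> Var 1)))"


section \<open>Elaboration of pure terms\<close>

text \<open>
  The encoding \<open>\<lambda>a. in ((\<lambda>a. (\<lambda>a. \<lambda>x\<^sub>1 \<dots> x\<^sub>n. x\<^sub>j a) a) a)\<close> of a constructor with \<open>k\<close> arguments,
  where \<open>a\<close> stands for \<open>a\<^sub>1 \<dots> a\<^sub>k\<close>. Here \<open>j\<close> counts from \<open>0\<close>, so \<open>x\<close>-number \<open>j\<close> has index
  \<open>n - 1 - j\<close> below the binders \<open>x\<close>, and \<open>arg_vars m k\<close> are the variables \<open>a\<close> seen from
  below \<open>m\<close> further binders.
\<close>

definition arg_vars :: "nat \<Rightarrow> nat \<Rightarrow> lam list" where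
  "arg_vars m k = map Var (rev [m..<m + k])"

definition con_tm :: "'d library \<Rightarrow> nat \<Rightarrow> nat \<Rightarrow> nat \<Rightarrow> lam" where
  "con_tm L n j k =
     lams k (In L \<cdot>
       apps (lams k
         (apps (lams k
            (lams n (apps (Var (n - 1 - j)) (arg_vars n k))))
          (arg_vars 0 k)))
       (arg_vars 0 k))"

text \<open>
  \<open>\<lambda>x. x (\<lambda>a\<^sub>1. t\<^sub>1') \<dots> (\<lambda>a\<^sub>n. t\<^sub>n')\<close>, the abstracted bodies being shifted past the binder \<open>x\<close>.
\<close>

definition case_fun :: "('d, 'c) case_tree \<Rightarrow> lam list \<Rightarrow> lam" where
  "case_fun bs ts =
     Lam (apps (Var 0) (map2 (\<lambda>b t. ren Suc (lams (arity b) t)) bs ts))"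

inductive elab :: "'d library \<Rightarrow> ('d, 'c) sctx \<Rightarrow> ('d, 'c) sterm \<Rightarrow> lam \<Rightarrow> bool"
    (\<open>_, _ \<turnstile> _ \<hookrightarrow> _\<close> [51, 51, 51, 51] 50)
  for L :: "'d library" and \<Gamma> :: "('d, 'c) sctx" where
  elab_var: "L, \<Gamma> \<turnstile> SVar i \<hookrightarrow> Var i"
| elab_lam: "L, \<Gamma> \<turnstile> t \<hookrightarrow> t' \<Longrightarrow> L, \<Gamma> \<turnstile> SLam t \<hookrightarrow> Lam t'"
| elab_app: "L, \<Gamma> \<turnstile> s \<hookrightarrow> s' \<Longrightarrow> L, \<Gamma> \<turnstile> t \<hookrightarrow> t' \<Longrightarrow> L, \<Gamma> \<turnstile> SApp s t \<hookrightarrow> s' \<cdot> t'"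
| elab_con: "(d, cs) \<in> set \<Gamma> \<Longrightarrow> j < length cs \<Longrightarrow> cs ! j = (c, k) \<Longrightarrow>
    L, \<Gamma> \<turnstile> SCon c \<hookrightarrow> con_tm L (length cs) j k"
| elab_is: "d \<in> fst ` set \<Gamma> \<Longrightarrow> L, \<Gamma> \<turnstile> SIs d \<hookrightarrow> is_elab L d"
| elab_to: "d \<in> fst ` set \<Gamma> \<Longrightarrow> L, \<Gamma> \<turnstile> STo d \<hookrightarrow> to_elab L d"
| elab_mu: "case_tree_for \<Gamma> d bs \<Longrightarrow> L, \<Gamma> \<turnstile> t \<hookrightarrow> t' \<Longrightarrow>
    list_all2 (\<lambda>b u. L, \<Gamma> \<turnstile> body b \<hookrightarrow> u) bs ts \<Longrightarrow>
    L, \<Gamma> \<turnstile> SMu t bs \<hookrightarrow> mu_tm L \<cdot> t' \<cdot> Lam (case_fun bs ts)"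
| elab_case: "case_tree_for \<Gamma> d bs \<Longrightarrow> L, \<Gamma> \<turnstile> t \<hookrightarrow> t' \<Longrightarrow>
    list_all2 (\<lambda>b u. L, \<Gamma> \<turnstile> body b \<hookrightarrow> u) bs ts \<Longrightarrow>
    L, \<Gamma> \<turnstile> SCase t bs \<hookrightarrow> case_tm L \<cdot> t' \<cdot> case_fun bs ts"

end

theory Submission
  imports Defs
begin

text \<open>
  Elaboration is deterministic and commutes with substitution, so the contractum elaborates to the
  substitution instance of the elaborated branch. For \<open>\<mu>'\<close>, the elaborated redex
  \<open>\<beta>\<close>-reduces to that instance. For \<open>\<mu>\<close>, Requirement 2 puts the reduct \<open>t\<close> of
  \<open>induction a\<close> in place of \<open>ih\<close>, whereas the contractum has the elaboration of the recursive
  function \<open>r\<close> there. That elaboration reduces to \<open>\<lambda>x. induction a x\<close>, hence by one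
  \<open>\<eta>\<close>-step and Requirement 2 also to \<open>t\<close>, so the two sides meet in the instance with
  \<open>t\<close>.
\<close>

section \<open>Renaming and substitution\<close>

lemma up_ren_comp: "up_ren n \<xi> \<circ> up_ren n \<zeta> = up_ren n (\<xi> \<circ> \<zeta>)"
  by (auto simp: up_ren_def fun_eq_iff)

lemma up_comp_up_ren: "up n \<sigma> \<circ> up_ren n \<xi> = up n (\<sigma> \<circ> \<xi>)"
  by (auto simp: up_ren_def up_def fun_eq_iff)

lemma ren_ren: "ren \<xi> (ren \<zeta> t) = ren (\<xi> \<circ> \<zeta>) t"
  by (induction t arbitrary: \<xi> \<zeta>) (simp_all add: up_ren_comp)

lemma sub_ren: "sub \<sigma> (ren \<xi> t) = sub (\<sigma> \<circ> \<xi>) t"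
  by (induction t arbitrary: \<sigma> \<xi>) (simp_all add: up_comp_up_ren)

lemma ren_shift: "ren (up_ren n \<xi>) (ren (\<lambda>x. x + n) t) = ren (\<lambda>x. x + n) (ren \<xi> t)"
  by (simp add: ren_ren comp_def up_ren_def)

lemma ren_up: "ren (up_ren n \<xi>) \<circ> up n \<sigma> = up n (ren \<xi> \<circ> \<sigma>)"
  by (auto simp: fun_eq_iff up_def ren_shift) (simp add: up_ren_def)

lemma ren_sub: "ren \<xi> (sub \<sigma> t) = sub (ren \<xi> \<circ> \<sigma>) t"
  by (induction t arbitrary: \<xi> \<sigma>) (simp_all add: ren_up)

lemma sub_shift: "sub (up n \<sigma>) (ren (\<lambda>x. x + n) t) = ren (\<lambda>x. x + n) (sub \<sigma> t)"
  by (simp add: sub_ren ren_sub comp_def up_def[of n \<sigma>])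

lemma sub_up: "sub (up n \<sigma>) \<circ> up n \<tau> = up n (sub \<sigma> \<circ> \<tau>)"
proof
  show "(sub (up n \<sigma>) \<circ> up n \<tau>) i = up n (sub \<sigma> \<circ> \<tau>) i" for i
    by (cases "i < n") (simp_all add: up_def[of n _ i] sub_shift)
qed

text \<open>Last of four composition laws that build on one another: passing a binder takes
  \<open>ren_ren\<close> for \<open>ren_sub\<close>, and \<open>sub_ren\<close> with
  \<open>ren_sub\<close> for this one.\<close>

lemma sub_sub: "sub \<sigma> (sub \<tau> t) = sub (sub \<sigma> \<circ> \<tau>) t"
  by (induction t arbitrary: \<sigma> \<tau>) (simp_all add: sub_up)

lemma up_Var: "up n Var = Var"
  by (auto simp: up_def fun_eq_iff)

lemma sub_Var: "sub Var t = t"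
  by (induction t) (simp_all add: up_Var)

lemma sub_Var_comp: "sub (\<lambda>i. Var (\<xi> i)) t = ren \<xi> t"
  using sub_ren[of Var \<xi> t] by (simp add: sub_Var comp_def)

lemma ren_ident: "ren (\<lambda>x. x) t = t"
  using sub_Var_comp[of "\<lambda>x. x" t] by (simp add: sub_Var)

lemma ren_Suc_up_ren: "ren (up_ren 1 \<xi>) (ren Suc t) = ren Suc (ren \<xi> t)"
  using ren_shift[of 1 \<xi> t] by simp

lemma sub_up_ren_Suc: "sub (up 1 \<sigma>) (ren Suc t) = ren Suc (sub \<sigma> t)"
  using sub_shift[of 1 \<sigma> t] by simp

lemma sub_case_nat_ren_Suc: "sub (case_nat u \<sigma>) (ren Suc t) = sub \<sigma> t"
  by (simp add: sub_ren comp_def)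

lemma up_up: "up m (up n \<sigma>) = up (m + n) \<sigma>"
  by (auto simp: up_def fun_eq_iff ren_ren comp_def add.commute add.left_commute)

lemma up_ren_up_ren: "up_ren m (up_ren n \<xi>) = up_ren (m + n) \<xi>"
  by (auto simp: up_ren_def fun_eq_iff)

lemma sub_cong_fv: "(\<And>i. i \<in> fv t \<Longrightarrow> \<sigma> i = \<tau> i) \<Longrightarrow> sub \<sigma> t = sub \<tau> t"
proof (induction t arbitrary: \<sigma> \<tau>)
  case (Lam t)
  have "sub (up 1 \<sigma>) t = sub (up 1 \<tau>) t"
  proof (rule Lam.IH)
    fix i
    assume "i \<in> fv t"
    then show "up 1 \<sigma> i = up 1 \<tau> i"
      \<comment> \<open>Index \<open>0\<close> is the new binder and is fixed on both sides; any
        other \<open>i\<close> is the index \<open>i - 1\<close> outside it.\<close>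
      using Lam.prems[of "i - 1"] by (cases i) (auto simp: up_def)
  qed
  then show ?case by simp
next
  case (App s t)
  have "sub \<sigma> s = sub \<tau> s" "sub \<sigma> t = sub \<tau> t"
    using App.prems by (auto intro: App.IH)
  then show ?case by simp
qed simp

lemma sub_closed: "closed t \<Longrightarrow> sub \<sigma> t = t"
  using sub_cong_fv[of t \<sigma> Var] by (simp add: closed_def sub_Var)

lemma ren_closed: "closed t \<Longrightarrow> ren \<xi> t = t"
  using sub_closed[of t "\<lambda>i. Var (\<xi> i)"] by (simp add: sub_Var_comp)

section \<open>Iterated abstraction, application and instantiation\<close>

lemma lams_0 [simp]: "lams 0 t = t"
  by (simp add: lams_def)

lemma lams_Suc [simp]: "lams (Suc n) t = Lam (lams n t)"
  by (simp add: lams_def)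

lemma apps_Nil [simp]: "apps t [] = t"
  by (simp add: apps_def)

lemma apps_Cons [simp]: "apps t (u # us) = apps (t \<cdot> u) us"
  by (simp add: apps_def)

lemma sub_lams: "sub \<sigma> (lams n t) = lams n (sub (up n \<sigma>) t)"
proof (induction n arbitrary: \<sigma>)
  case 0
  have "up 0 \<sigma> = \<sigma>"
    by (simp add: up_def fun_eq_iff ren_ident)
  then show ?case by simp
qed (simp add: up_up)

lemma ren_lams: "ren \<xi> (lams n t) = lams n (ren (up_ren n \<xi>) t)"
proof (induction n arbitrary: \<xi>)
  case 0
  have "up_ren 0 \<xi> = \<xi>"
    by (auto simp: up_ren_def)
  then show ?case by simp
qed (simp add: up_ren_up_ren)

lemma sub_apps: "sub \<sigma> (apps t us) = apps (sub \<sigma> t) (map (sub \<sigma>) us)"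
  by (induction us arbitrary: t) simp_all

lemma ren_apps: "ren \<xi> (apps t us) = apps (ren \<xi> t) (map (ren \<xi>) us)"
  by (induction us arbitrary: t) simp_all

lemma fv_lams: "fv (lams n t) = {i. i + n \<in> fv t}"
  by (induction n) simp_all

lemma fv_apps: "fv (apps t us) = fv t \<union> (\<Union>u \<in> set us. fv u)"
  by (induction us arbitrary: t) auto

lemma fv_arg_vars: "(\<Union>u \<in> set (arg_vars m k). fv u) = {m..<m + k}"
  by (auto simp: arg_vars_def)

text \<open>Target counterpart of \<open>inst\<close>: arguments are listed from the outermost
  binder, whereas index \<open>0\<close> is the innermost one, hence \<open>rev\<close>.\<close>

definition inst_lam :: "lam list \<Rightarrow> nat \<Rightarrow> lam" where
  "inst_lam us i = (if i < length us then rev us ! i else Var (i - length us))"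

text \<open>Splits off the first argument, as contracting an iterated redex does: \<open>u\<close>
  replaces the outermost binder while the other \<open>length us\<close> are still present, so
  \<open>up\<close> shifts it past them, and the later instantiation cancels that shift.\<close>

lemma inst_lam_Cons:
  "sub (inst_lam us) (sub (up (length us) (case_nat u Var)) t) = sub (inst_lam (u # us)) t"
proof -
  have "sub (inst_lam us) (up (length us) (case_nat u Var) i) = inst_lam (u # us) i" for i
  proof (cases "i < length us")
    case True
    then show ?thesis by (simp add: up_def inst_lam_def nth_append)
  next
    case False
    have "sub (inst_lam us) (ren (\<lambda>x. x + length us) s) = s" for s
      by (simp add: sub_ren comp_def inst_lam_def sub_Var)
    with False show ?thesis
      by (auto simp: up_def inst_lam_def nth_append split: nat.split)
  qed
  then show ?thesis by (simp add: sub_sub comp_def)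
qed

text \<open>For the layers \<open>\<lambda>a. F a\<close> of a constructor encoding, which thus hand
  their arguments on unchanged. The reversals in \<open>arg_vars\<close> and \<open>inst_lam\<close>
  cancel.\<close>

lemma inst_lam_arg_vars:
  assumes "length us = k"
  shows "map (sub (inst_lam us)) (arg_vars 0 k) = us"
  using assms by (auto simp: arg_vars_def inst_lam_def rev_nth intro!: nth_equalityI)

lemma up_inst_lam_arg_vars:
  assumes "length us = k"
  shows "map (sub (up n (inst_lam us))) (arg_vars n k) = map (ren (\<lambda>x. x + n)) us"
  using assms by (auto simp: arg_vars_def up_def inst_lam_def rev_nth intro!: nth_equalityI)

section \<open>Reduction\<close>

lemma betaetas_appL: "s \<leadsto>\<^sup>* s' \<Longrightarrow> s \<cdot> t \<leadsto>\<^sup>* s' \<cdot> t"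
  by (induction rule: rtranclp_induct) (auto intro: betaeta_appL rtranclp.rtrancl_into_rtrancl)

lemma betaetas_appR: "t \<leadsto>\<^sup>* t' \<Longrightarrow> s \<cdot> t \<leadsto>\<^sup>* s \<cdot> t'"
  by (induction rule: rtranclp_induct) (auto intro: betaeta_appR rtranclp.rtrancl_into_rtrancl)

lemma betaetas_app: "s \<leadsto>\<^sup>* s' \<Longrightarrow> t \<leadsto>\<^sup>* t' \<Longrightarrow> s \<cdot> t \<leadsto>\<^sup>* s' \<cdot> t'"
  by (meson betaetas_appL betaetas_appR rtranclp_trans)

lemma betaetas_lam: "t \<leadsto>\<^sup>* t' \<Longrightarrow> Lam t \<leadsto>\<^sup>* Lam t'"
  by (induction rule: rtranclp_induct) (auto intro: betaeta_lam rtranclp.rtrancl_into_rtrancl)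

lemma betaetas_apps: "t \<leadsto>\<^sup>* t' \<Longrightarrow> apps t us \<leadsto>\<^sup>* apps t' us"
  by (induction us arbitrary: t t') (simp_all add: betaetas_appL)

lemma betaetas_beta: "u = sub (case_nat t Var) s \<Longrightarrow> Lam s \<cdot> t \<leadsto>\<^sup>* u"
  by (auto intro: betaeta_beta)

text \<open>Needed for \<open>betaetas_sub\<close>, where the substituted terms are shifted on
  passing a binder.\<close>

lemma betaeta_ren: "s \<leadsto> t \<Longrightarrow> ren \<xi> s \<leadsto> ren \<xi> t"
proof (induction arbitrary: \<xi> rule: betaeta.induct)
  case (betaeta_beta s t)
  have "ren \<xi> \<circ> case_nat t Var = case_nat (ren \<xi> t) Var \<circ> up_ren 1 \<xi>"
    by (auto simp: fun_eq_iff up_ren_def split: nat.split)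
  then have "ren \<xi> (sub (case_nat t Var) s) = sub (case_nat (ren \<xi> t) Var) (ren (up_ren 1 \<xi>) s)"
    by (simp add: ren_sub sub_ren)
  then show ?case by (simp add: betaeta.betaeta_beta)
next
  case (betaeta_eta s)
  have "ren \<xi> (Lam (ren Suc s \<cdot> Var 0)) = Lam (ren Suc (ren \<xi> s) \<cdot> Var 0)"
    by (simp add: ren_Suc_up_ren[unfolded One_nat_def]) (simp add: up_ren_def)
  then show ?case by (metis betaeta.betaeta_eta)
qed (auto intro: betaeta.intros)

lemma betaetas_ren: "s \<leadsto>\<^sup>* t \<Longrightarrow> ren \<xi> s \<leadsto>\<^sup>* ren \<xi> t"
  by (induction rule: rtranclp_induct) (auto intro: betaeta_ren rtranclp.rtrancl_into_rtrancl)

text \<open>Each occurrence of a variable reduces separately, so one step in \<sigma> may become any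
  number of steps. This later turns the recursive function substituted for \<open>ih\<close> into
  the term given by Requirement 2.\<close>

lemma betaetas_sub: "(\<And>i. \<sigma> i \<leadsto>\<^sup>* \<tau> i) \<Longrightarrow> sub \<sigma> t \<leadsto>\<^sup>* sub \<tau> t"
proof (induction t arbitrary: \<sigma> \<tau>)
  case (Lam t)
  have "up 1 \<sigma> i \<leadsto>\<^sup>* up 1 \<tau> i" for i
    by (simp add: up_def betaetas_ren Lam.prems)
  then show ?case using Lam.IH by (simp add: betaetas_lam)
qed (auto intro: betaetas_app)

text \<open>Each step contracts the outermost binder and changes both the body and the number of
  binders left, hence the generalisation over \<open>k\<close> and \<open>t\<close>;
  \<open>inst_lam_Cons\<close> merges the successive substitutions.\<close>

lemma apps_lams: "length us = k \<Longrightarrow> apps (lams k t) us \<leadsto>\<^sup>* sub (inst_lam us) t"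
proof (induction us arbitrary: k t)
  case Nil
  have "inst_lam [] = Var"
    by (auto simp: inst_lam_def)
  with Nil show ?case by (simp add: sub_Var)
next
  case (Cons u us)
  then have k: "k = Suc (length us)" by simp
  have "Lam (lams (length us) t) \<cdot> u \<leadsto>\<^sup>*
      lams (length us) (sub (up (length us) (case_nat u Var)) t)"
    by (rule betaetas_beta) (simp add: sub_lams)
  from betaetas_apps[OF this, of us] Cons.IH[OF refl] show ?case
    unfolding k inst_lam_Cons[symmetric] lams_Suc apps_Cons by (rule rtranclp_trans)
qed

section \<open>Encodings of constructors, case analysis and recursion\<close>

text \<open>The Scott-style node \<open>\<lambda>x_1 ... x_n. x_j us\<close>, which is what
  \<open>In\<close> wraps once a constructor has its arguments.\<close>

definition con_data :: "nat \<Rightarrow> nat \<Rightarrow> lam list \<Rightarrow> lam" where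
  "con_data n j us = lams n (apps (Var (n - 1 - j)) (map (ren (\<lambda>x. x + n)) us))"

lemma closed_con_tm:
  assumes "closed (In L)" "j < n"
  shows "closed (con_tm L n j k)"
proof -
  \<comment> \<open>The head index lies below \<open>n\<close> and the argument indices lie in
    \<open>{n..<n + k}\<close>, so the \<open>n + k\<close> abstractions bind them all.\<close>
  have "fv (lams k (lams n (apps (Var (n - 1 - j)) (arg_vars n k)))) = {}"
    using assms by (auto simp: fv_lams fv_apps fv_arg_vars)
  then show ?thesis
    using assms
    by (auto simp: closed_def con_tm_def fv_lams fv_apps fv_arg_vars)
qed

text \<open>The encoding has three layers that hand the arguments inward. The two inner ones,
  \<open>G\<close> and \<open>E\<close>, are closed, so instantiating the layer around them leaves
  them intact, and three uses of \<open>apps_lams\<close> reach the node.\<close>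

lemma con_tm_apps:
  assumes "closed (In L)" "j < n" "length us = k"
  shows "apps (con_tm L n j k) us \<leadsto>\<^sup>* In L \<cdot> con_data n j us"
proof -
  define E where "E = lams k (lams n (apps (Var (n - 1 - j)) (arg_vars n k)))"
  define G where "G = lams k (apps E (arg_vars 0 k))"
  have cE: "closed E"
    using assms(2) by (auto simp: closed_def E_def fv_lams fv_apps fv_arg_vars)
  have cG: "closed G"
    using cE by (auto simp: closed_def G_def fv_lams fv_apps fv_arg_vars)
  have "up n (inst_lam us) (n - 1 - j) = Var (n - 1 - j)"
    using assms(2) by (simp add: up_def)
  then have "sub (inst_lam us) (lams n (apps (Var (n - 1 - j)) (arg_vars n k))) = con_data n j us"
    by (simp add: con_data_def sub_lams sub_apps up_inst_lam_arg_vars[OF assms(3)])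
  then have E: "apps E us \<leadsto>\<^sup>* con_data n j us"
    using apps_lams[OF assms(3)] unfolding E_def by metis
  have "sub (inst_lam us) (apps E (arg_vars 0 k)) = apps E us"
    by (simp add: sub_apps sub_closed[OF cE] inst_lam_arg_vars[OF assms(3)])
  then have G: "apps G us \<leadsto>\<^sup>* apps E us"
    using apps_lams[OF assms(3)] unfolding G_def by metis
  have "sub (inst_lam us) (In L \<cdot> apps G (arg_vars 0 k)) = In L \<cdot> apps G us"
    by (simp add: sub_apps sub_closed[OF cG] sub_closed[OF assms(1)] inst_lam_arg_vars[OF assms(3)])
  then have "apps (con_tm L n j k) us \<leadsto>\<^sup>* In L \<cdot> apps G us"
    using apps_lams[OF assms(3)] unfolding con_tm_def G_def E_def by metis
  also have "\<dots> \<leadsto>\<^sup>* In L \<cdot> con_data n j us"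
    by (rule betaetas_appR) (rule rtranclp_trans[OF G E])
  finally show ?thesis .
qed

lemma sub_case_fun:
  "sub \<sigma> (case_fun bs ts) = case_fun bs (map2 (\<lambda>b t. sub (up (arity b) \<sigma>) t) bs ts)"
proof -
  have "sub (up 1 \<sigma>) (ren Suc (lams k t)) = ren Suc (lams k (sub (up k \<sigma>) t))" for k t
    by (simp only: sub_up_ren_Suc sub_lams)
  then show ?thesis
    by (auto simp: case_fun_def sub_apps up_def intro!: arg_cong[of _ _ "apps _"] nth_equalityI)
qed

lemma ren_case_fun:
  "ren \<xi> (case_fun bs ts) = case_fun bs (map2 (\<lambda>b t. ren (up_ren (arity b) \<xi>) t) bs ts)"
proof -
  have "ren (up_ren 1 \<xi>) (ren Suc (lams k t)) = ren Suc (lams k (ren (up_ren k \<xi>) t))" for k t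
    \<comment> \<open>In a single pass \<open>ren_lams\<close> could first move the inner shift
      below the abstractions, where the shift law no longer matches.\<close>
    by (simp only: ren_Suc_up_ren) (simp only: ren_lams)
  then show ?thesis
    by (auto simp: case_fun_def ren_apps up_ren_def intro!: arg_cong[of _ _ "apps _"] nth_equalityI)
qed

text \<open>The case function hands the branches to the node, whose variable \<open>x_j\<close>
  selects branch \<open>j\<close> and applies it to \<open>us\<close>; contracting the pattern
  binders finishes.\<close>

lemma case_fun_con_data:
  assumes "length ts = length bs" "j < length bs" "length us = arity (bs ! j)"
  shows "case_fun bs ts \<cdot> con_data (length bs) j us \<leadsto>\<^sup>* sub (inst_lam us) (ts ! j)"
proof -
  let ?n = "length bs"
  define vs where "vs = map2 (\<lambda>b t. lams (arity b) t) bs ts"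
  have len: "length vs = ?n"
    using assms by (simp add: vs_def)
  have idx: "?n - Suc j < ?n"
    using assms(2) by linarith
  have "case_fun bs ts \<cdot> con_data ?n j us \<leadsto>\<^sup>* apps (con_data ?n j us) vs"
    unfolding case_fun_def vs_def
    by (rule betaetas_beta) (simp add: sub_apps sub_case_nat_ren_Suc sub_Var comp_def case_prod_unfold)
  also have "\<dots> \<leadsto>\<^sup>* sub (inst_lam vs) (apps (Var (?n - 1 - j)) (map (ren (\<lambda>x. x + ?n)) us))"
    unfolding con_data_def by (rule apps_lams[OF len])
  also have "\<dots> = apps (vs ! j) us"
    \<comment> \<open>Index \<open>n - 1 - j\<close> counts from the innermost binder, so in
      \<open>rev vs\<close> it is entry \<open>j\<close> of \<open>vs\<close>. The instantiation
      also cancels the shift of \<open>us\<close>.\<close>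
    using assms len idx
    by (simp add: sub_apps inst_lam_def rev_nth sub_ren comp_def sub_Var)
  also have "vs ! j = lams (arity (bs ! j)) (ts ! j)"
    using assms by (simp add: vs_def)
  also have "apps \<dots> us \<leadsto>\<^sup>* sub (inst_lam us) (ts ! j)"
    using assms by (simp add: apps_lams)
  finally show ?thesis .
qed

lemma beta_imp_betaeta: "s \<rightarrow>\<^sub>\<beta> t \<Longrightarrow> s \<leadsto> t"
  by (induction rule: beta.induct) (auto intro: betaeta.intros)

text \<open>Taken from the bounded \<beta>-reduction clause of Requirement 1, which provides a
  directed reduction rather than a conversion.\<close>

lemma Out_In:
  assumes "encoding_library L"
  shows "Out L \<cdot> (In L \<cdot> xs) \<leadsto>\<^sup>* xs"
proof -
  obtain m where "(beta ^^ m) (Out L \<cdot> (In L \<cdot> xs)) xs"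
    using assms unfolding encoding_library_def requirement1_def by blast
  then have "beta\<^sup>*\<^sup>* (Out L \<cdot> (In L \<cdot> xs)) xs"
    by (rule relpowp_imp_rtranclp)
  then show ?thesis
    by (rule rtranclp_mono[THEN predicate2D, rotated]) (auto intro: beta_imp_betaeta)
qed

lemma case_tm_apps:
  assumes "closed (Out L)"
  shows "case_tm L \<cdot> t \<cdot> f \<leadsto>\<^sup>* f \<cdot> (Out L \<cdot> t)"
proof -
  have "case_tm L \<cdot> t \<leadsto>\<^sup>* Lam (Var 0 \<cdot> (Out L \<cdot> ren Suc t))"
    unfolding case_tm_def
    by (rule betaetas_beta) (simp add: up_def sub_closed[OF assms])
  then have "case_tm L \<cdot> t \<cdot> f \<leadsto>\<^sup>* Lam (Var 0 \<cdot> (Out L \<cdot> ren Suc t)) \<cdot> f"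
    by (rule betaetas_appL)
  also have "\<dots> \<leadsto>\<^sup>* f \<cdot> (Out L \<cdot> t)"
    by (rule betaetas_beta) (simp add: sub_closed[OF assms] sub_case_nat_ren_Suc sub_Var)
  finally show ?thesis .
qed

text \<open>The argument of \<open>Induction\<close> in \<open>mu_tm\<close> once \<open>f\<close>
  is supplied; \<open>f\<close> is shifted past \<open>o\<close>, \<open>ih\<close> and
  \<open>xs\<close>.\<close>

definition mu_alg :: "lam \<Rightarrow> lam" where
  "mu_alg f = Lam (Lam (Lam (ren (\<lambda>x. x + 3) f \<cdot> Var 1 \<cdot> Var 0)))"

lemma ren_mu_alg: "ren \<xi> (mu_alg f) = mu_alg (ren \<xi> f)"
proof -
  \<comment> \<open>The three single lifts become one lift by \<open>3\<close>, so that
    \<open>ren_shift\<close> matches the shift of \<open>f\<close>.\<close>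
  have "up_ren 1 (up_ren 1 (up_ren 1 \<xi>)) = up_ren 3 \<xi>"
    by (simp add: up_ren_up_ren eval_nat_numeral)
  then show ?thesis
    by (simp add: mu_alg_def ren_shift) (simp add: up_ren_def)
qed

lemma mu_tm_apps:
  assumes "closed (Induction L)"
  shows "mu_tm L \<cdot> t \<cdot> f \<leadsto>\<^sup>* Induction L \<cdot> mu_alg f \<cdot> t"
proof -
  \<comment> \<open>\<open>Var 3\<close> is the \<open>f\<close> bound by \<open>mu_tm\<close> just
    outside the three abstractions; contracting that binder turns \<open>?A\<close> into
    \<open>mu_alg f\<close>.\<close>
  let ?A = "Lam (Lam (Lam (Var 3 \<cdot> Var 1 \<cdot> Var 0)))"
  have "mu_tm L \<cdot> t \<leadsto>\<^sup>* Lam (Induction L \<cdot> ?A \<cdot> ren Suc t)"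
    unfolding mu_tm_def
    by (rule betaetas_beta) (simp add: up_def sub_closed[OF assms])
  then have "mu_tm L \<cdot> t \<cdot> f \<leadsto>\<^sup>* Lam (Induction L \<cdot> ?A \<cdot> ren Suc t) \<cdot> f"
    by (rule betaetas_appL)
  also have "\<dots> \<leadsto>\<^sup>* Induction L \<cdot> mu_alg f \<cdot> t"
    by (rule betaetas_beta)
      (simp add: sub_closed[OF assms] sub_case_nat_ren_Suc sub_Var mu_alg_def up_def
        ren_ren comp_def eval_nat_numeral)
  finally show ?thesis .
qed

lemma mu_alg_apps: "mu_alg f \<cdot> s \<cdot> t \<cdot> u \<leadsto>\<^sup>* f \<cdot> t \<cdot> u"
proof -
  have *: "mu_alg f = lams 3 (ren (\<lambda>x. x + 3) f \<cdot> Var 1 \<cdot> Var 0)"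
    by (simp add: mu_alg_def eval_nat_numeral)
  show ?thesis
    using apps_lams[of "[s, t, u]" 3 "ren (\<lambda>x. x + 3) f \<cdot> Var 1 \<cdot> Var 0"]
    by (simp add: * inst_lam_def sub_ren comp_def sub_Var)
qed

text \<open>The left side is the shape of the elaborated recursive function. Below its binder
  \<open>mu_tm\<close> unfolds to a shifted term applied to \<open>Var 0\<close>, an \<eta>-redex;
  contracting it leaves the very application whose reduct Requirement 2 supplies.\<close>

lemma Lam_mu_tm:
  assumes "closed (Induction L)"
  shows "Lam (mu_tm L \<cdot> Var 0 \<cdot> ren Suc f) \<leadsto>\<^sup>* Induction L \<cdot> mu_alg f"
proof -
  have "Lam (mu_tm L \<cdot> Var 0 \<cdot> ren Suc f) \<leadsto>\<^sup>* Lam (ren Suc (Induction L \<cdot> mu_alg f) \<cdot> Var 0)"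
    by (simp add: betaetas_lam mu_tm_apps[OF assms] ren_mu_alg ren_closed[OF assms])
  also have "\<dots> \<leadsto>\<^sup>* Induction L \<cdot> mu_alg f"
    by (rule r_into_rtranclp) (rule betaeta_eta)
  finally show ?thesis .
qed

section \<open>Elaboration\<close>

inductive_cases elab_SVarE: "L, \<Gamma> \<turnstile> SVar i \<hookrightarrow> u"
inductive_cases elab_SLamE: "L, \<Gamma> \<turnstile> SLam t \<hookrightarrow> u"
inductive_cases elab_SAppE: "L, \<Gamma> \<turnstile> SApp s t \<hookrightarrow> u"
inductive_cases elab_SIsE: "L, \<Gamma> \<turnstile> SIs d \<hookrightarrow> u"
inductive_cases elab_SToE: "L, \<Gamma> \<turnstile> STo d \<hookrightarrow> u"
inductive_cases elab_SMuE: "L, \<Gamma> \<turnstile> SMu t bs \<hookrightarrow> u"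
inductive_cases elab_SCaseE: "L, \<Gamma> \<turnstile> SCase t bs \<hookrightarrow> u"

lemma closed_mu_tm: "closed (Induction L) \<Longrightarrow> closed (mu_tm L)"
  by (auto simp: closed_def mu_tm_def)

lemma closed_case_tm: "closed (Out L) \<Longrightarrow> closed (case_tm L)"
  by (auto simp: closed_def case_tm_def)

text \<open>Renaming and substitution rewrite only the bodies of a case tree, while
  \<open>case_fun\<close> reads only its arities and takes the elaborated bodies from
  \<open>ts\<close>.\<close>

lemma case_fun_map:
  "case_fun (map (\<lambda>b. Branch (ctor b) (arity b) (g b)) bs) ts = case_fun bs ts"
  by (auto simp: case_fun_def intro!: arg_cong[of _ _ "apps _"] nth_equalityI)

lemma case_tree_for_map:
  "case_tree_for \<Gamma> d (map (\<lambda>b. Branch (ctor b) (arity b) (g b)) bs) = case_tree_for \<Gamma> d bs"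
  by (simp add: case_tree_for_def comp_def)

lemma elab_sren:
  assumes "encoding_library L" "L, \<Gamma> \<turnstile> t \<hookrightarrow> t'"
  shows "L, \<Gamma> \<turnstile> sren \<xi> t \<hookrightarrow> ren \<xi> t'"
  using assms(2)
proof (induction arbitrary: \<xi> rule: elab.induct)
  case (elab_con d cs j c k)
  then have "ren \<xi> (con_tm L (length cs) j k) = con_tm L (length cs) j k"
    using assms(1) by (auto intro!: ren_closed closed_con_tm simp: encoding_library_def)
  with elab_con show ?case by (auto intro: elab.intros)
next
  case (elab_mu d bs t t' ts)
  \<comment> \<open>The \<open>Suc\<close> accounts for \<open>ih\<close>, bound outside the pattern
    variables; in the target it is the \<open>Lam\<close> around \<open>case_fun\<close>, and the
    two lifts merge by \<open>up_ren_up_ren\<close>.\<close>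
  let ?bs = "map (\<lambda>b. Branch (ctor b) (arity b) (sren (up_ren (Suc (arity b)) \<xi>) (body b))) bs"
  let ?ts = "map2 (\<lambda>b t. ren (up_ren (Suc (arity b)) \<xi>) t) bs ts"
  have "list_all2 (\<lambda>b u. L, \<Gamma> \<turnstile> body b \<hookrightarrow> u) ?bs ?ts"
    using elab_mu.IH by (auto simp: list_all2_conv_all_nth)
  moreover have "ren \<xi> (mu_tm L \<cdot> t' \<cdot> Lam (case_fun bs ts)) =
      mu_tm L \<cdot> ren \<xi> t' \<cdot> Lam (case_fun ?bs ?ts)"
    using assms(1)
    by (simp add: ren_case_fun case_fun_map up_ren_up_ren ren_closed closed_mu_tm
        encoding_library_def)
  ultimately show ?case
    using elab_mu elab.elab_mu[of \<Gamma> d ?bs L "sren \<xi> t" "ren \<xi> t'" ?ts]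
    by (simp add: case_tree_for_map)
next
  case (elab_case d bs t t' ts)
  let ?bs = "map (\<lambda>b. Branch (ctor b) (arity b) (sren (up_ren (arity b) \<xi>) (body b))) bs"
  let ?ts = "map2 (\<lambda>b t. ren (up_ren (arity b) \<xi>) t) bs ts"
  have "list_all2 (\<lambda>b u. L, \<Gamma> \<turnstile> body b \<hookrightarrow> u) ?bs ?ts"
    using elab_case.IH by (auto simp: list_all2_conv_all_nth)
  moreover have "ren \<xi> (case_tm L \<cdot> t' \<cdot> case_fun bs ts) =
      case_tm L \<cdot> ren \<xi> t' \<cdot> case_fun ?bs ?ts"
    using assms(1)
    by (simp add: ren_case_fun case_fun_map ren_closed closed_case_tm encoding_library_def)
  ultimately show ?case
    using elab_case elab.elab_case[of \<Gamma> d ?bs L "sren \<xi> t" "ren \<xi> t'" ?ts]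
    by (simp add: case_tree_for_map)
qed (use assms(1) in \<open>auto simp: encoding_library_def ren_closed intro: elab.intros\<close>)

lemma elab_sup_sub:
  assumes "encoding_library L" "\<And>i. L, \<Gamma> \<turnstile> \<sigma> i \<hookrightarrow> \<tau> i"
  shows "L, \<Gamma> \<turnstile> sup_sub n \<sigma> i \<hookrightarrow> up n \<tau> i"
  using assms by (auto simp: sup_sub_def up_def intro: elab_sren elab.intros)

text \<open>The constants inserted by elaboration are closed, so substitution fixes them, and
  \<open>elab_sup_sub\<close> carries the relation between \<sigma> and \<tau> under
  binders.\<close>

lemma elab_ssub:
  assumes "encoding_library L" "L, \<Gamma> \<turnstile> t \<hookrightarrow> t'" "\<And>i. L, \<Gamma> \<turnstile> \<sigma> i \<hookrightarrow> \<tau> i"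
  shows "L, \<Gamma> \<turnstile> ssub \<sigma> t \<hookrightarrow> sub \<tau> t'"
  using assms(2,3)
proof (induction arbitrary: \<sigma> \<tau> rule: elab.induct)
  case (elab_lam t t')
  then show ?case
    using elab_sup_sub[OF assms(1) elab_lam.prems] by (auto intro: elab.intros)
next
  case (elab_con d cs j c k)
  then have "sub \<tau> (con_tm L (length cs) j k) = con_tm L (length cs) j k"
    using assms(1) by (auto intro!: sub_closed closed_con_tm simp: encoding_library_def)
  with elab_con show ?case by (auto intro: elab.intros)
next
  case (elab_mu d bs t t' ts)
  let ?bs = "map (\<lambda>b. Branch (ctor b) (arity b) (ssub (sup_sub (Suc (arity b)) \<sigma>) (body b))) bs"
  let ?ts = "map2 (\<lambda>b t. sub (up (Suc (arity b)) \<tau>) t) bs ts"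
  have "list_all2 (\<lambda>b u. L, \<Gamma> \<turnstile> body b \<hookrightarrow> u) ?bs ?ts"
    using elab_mu.IH elab_sup_sub[OF assms(1) elab_mu.prems] by (auto simp: list_all2_conv_all_nth)
  moreover have "sub \<tau> (mu_tm L \<cdot> t' \<cdot> Lam (case_fun bs ts)) =
      mu_tm L \<cdot> sub \<tau> t' \<cdot> Lam (case_fun ?bs ?ts)"
    using assms(1)
    by (simp add: sub_case_fun case_fun_map up_up sub_closed closed_mu_tm
        encoding_library_def)
  ultimately show ?case
    using elab_mu elab.elab_mu[of \<Gamma> d ?bs L "ssub \<sigma> t" "sub \<tau> t'" ?ts]
    by (simp add: case_tree_for_map)
next
  case (elab_case d bs t t' ts)
  let ?bs = "map (\<lambda>b. Branch (ctor b) (arity b) (ssub (sup_sub (arity b) \<sigma>) (body b))) bs"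
  let ?ts = "map2 (\<lambda>b t. sub (up (arity b) \<tau>) t) bs ts"
  have "list_all2 (\<lambda>b u. L, \<Gamma> \<turnstile> body b \<hookrightarrow> u) ?bs ?ts"
    using elab_case.IH elab_sup_sub[OF assms(1) elab_case.prems]
    by (auto simp: list_all2_conv_all_nth)
  moreover have "sub \<tau> (case_tm L \<cdot> t' \<cdot> case_fun bs ts) =
      case_tm L \<cdot> sub \<tau> t' \<cdot> case_fun ?bs ?ts"
    using assms(1)
    by (simp add: sub_case_fun case_fun_map sub_closed closed_case_tm encoding_library_def)
  ultimately show ?case
    using elab_case elab.elab_case[of \<Gamma> d ?bs L "ssub \<sigma> t" "sub \<tau> t'" ?ts]
    by (simp add: case_tree_for_map)
qed (use assms(1) in \<open>auto simp: encoding_library_def sub_closed intro: elab.intros\<close>)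

section \<open>Determinism of elaboration\<close>

lemma distinct_concat_map_unique:
  assumes "distinct (concat (map f xs))" "x \<in> set xs" "y \<in> set xs" "z \<in> set (f x)" "z \<in> set (f y)"
  shows "x = y"
  using assms by (induction xs) auto

text \<open>Disjointness of the constructor lists of different declarations fixes the declaration;
  distinctness within that list then fixes the position.\<close>

lemma constructor_unique:
  assumes "surface_context \<Gamma>"
    and "(d, cs) \<in> set \<Gamma>" "j < length cs" "cs ! j = (c, k)"
    and "(d', cs') \<in> set \<Gamma>" "j' < length cs'" "cs' ! j' = (c, k')"
  shows "cs' = cs \<and> j' = j \<and> k' = k"
proof -
  have dist: "distinct (concat (map (\<lambda>(d, cs). map fst cs) \<Gamma>))"
    using assms(1) by (simp add: surface_context_def)
  have "c = fst (cs ! j)" "c = fst (cs' ! j')"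
    using assms(4,7) by simp_all
  then have "c \<in> set (map fst cs)" "c \<in> set (map fst cs')"
    using assms(3,6) by (auto simp: image_iff) (metis nth_mem)+
  then have eq: "cs' = cs"
    using distinct_concat_map_unique[OF dist assms(2,5), of c] by auto
  have "distinct (map fst cs)"
    using dist assms(2) by (auto simp: distinct_concat_iff)
  then have "j' = j"
    using assms(3,4,6,7) eq nth_eq_iff_index_eq[of "map fst cs" j j'] by simp
  with eq assms(4,7) show ?thesis by simp
qed

text \<open>The rules are syntax-directed; where the constructor rule could choose a declaration and
  a position, \<open>constructor_unique\<close> removes the choice.\<close>

lemma elab_unique:
  assumes "surface_context \<Gamma>" "L, \<Gamma> \<turnstile> t \<hookrightarrow> u" "L, \<Gamma> \<turnstile> t \<hookrightarrow> v"
  shows "u = v"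
  using assms(2,3)
proof (induction arbitrary: v rule: elab.induct)
  case (elab_con d cs j c k)
  from elab_con.prems show ?case
  proof cases
    case (elab_con d' cs' j' k')
    with constructor_unique[OF assms(1) elab_con.hyps] show ?thesis by blast
  qed
next
  case (elab_mu d bs t t' ts)
  from elab_mu.prems show ?case
  proof cases
    case (elab_mu d' t'' ts')
    moreover have "ts = ts'"
      using elab_mu.IH(2) elab_mu(4)
      by (auto simp: list_all2_conv_all_nth intro!: nth_equalityI)
    ultimately show ?thesis using elab_mu.IH(1) by blast
  qed
next
  case (elab_case d bs t t' ts)
  from elab_case.prems show ?case
  proof cases
    case (elab_case d' t'' ts')
    moreover have "ts = ts'"
      using elab_case.IH(2) elab_case(4)
      by (auto simp: list_all2_conv_all_nth intro!: nth_equalityI)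
    ultimately show ?thesis using elab_case.IH(1) by blast
  qed
qed (blast elim: elab_SVarE elab_SLamE elab_SAppE elab_SIsE elab_SToE)+

section \<open>Elaboration of redexes and contracta\<close>

lemma elab_sappsE:
  assumes "L, \<Gamma> \<turnstile> sapps h ss \<hookrightarrow> e"
  obtains h' us where "e = apps h' us" "L, \<Gamma> \<turnstile> h \<hookrightarrow> h'" "list_all2 (elab L \<Gamma>) ss us"
  using assms
\<comment> \<open>The spine is a left fold, so each argument is absorbed into the head; hence the
  head is generalised.\<close>
proof (induction ss arbitrary: h thesis)
  case Nil
  then show ?case by (simp add: sapps_def)
next
  case (Cons s ss)
  from Cons.prems(2) have "L, \<Gamma> \<turnstile> sapps (SApp h s) ss \<hookrightarrow> e"
    by (simp add: sapps_def)
  then obtain f us where f: "e = apps f us" "L, \<Gamma> \<turnstile> SApp h s \<hookrightarrow> f" "list_all2 (elab L \<Gamma>) ss us"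
    using Cons.IH by metis
  from f(2) obtain h' u where "f = h' \<cdot> u" "L, \<Gamma> \<turnstile> h \<hookrightarrow> h'" "L, \<Gamma> \<turnstile> s \<hookrightarrow> u"
    by (rule elab_SAppE)
  with f show ?case by (intro Cons.prems(1)[of h' "u # us"]) simp_all
qed

text \<open>Lets a redex be matched against the reduction rules. The induction runs from the last
  argument, which belongs to the outermost application.\<close>

lemma sapps_SCon_eq:
  assumes "sapps (SCon c) ss = sapps (SCon c') ss'"
  shows "c = c' \<and> ss = ss'"
  using assms
proof (induction ss arbitrary: ss' rule: rev_induct)
  case Nil
  then show ?case by (cases ss' rule: rev_cases) (auto simp: sapps_def)
next
  case (snoc s ss)
  then show ?case by (cases ss' rule: rev_cases) (auto simp: sapps_def)
qed

lemma elab_inst: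
  assumes "list_all2 (elab L \<Gamma>) ss us"
  shows "L, \<Gamma> \<turnstile> inst ss i \<hookrightarrow> inst_lam us i"
  using assms
  by (auto simp: inst_def inst_lam_def list_all2_conv_all_nth rev_nth intro: elab.intros)

text \<open>The shifts of the single bodies past \<open>x\<close> in \<open>rec_fun\<close> amount
  to one \<open>ren Suc\<close> of the elaborated case function, the form that
  \<open>Lam_mu_tm\<close> expects.\<close>

lemma elab_rec_fun:
  assumes "encoding_library L" "case_tree_for \<Gamma> d bs"
    and "list_all2 (\<lambda>b u. L, \<Gamma> \<turnstile> body b \<hookrightarrow> u) bs ts"
  shows "L, \<Gamma> \<turnstile> rec_fun bs \<hookrightarrow> Lam (mu_tm L \<cdot> Var 0 \<cdot> ren Suc (Lam (case_fun bs ts)))"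
proof -
  let ?bs = "map (\<lambda>b. Branch (ctor b) (arity b) (sren (up_ren (Suc (arity b)) Suc) (body b))) bs"
  let ?ts = "map2 (\<lambda>b t. ren (up_ren (Suc (arity b)) Suc) t) bs ts"
  have "list_all2 (\<lambda>b u. L, \<Gamma> \<turnstile> body b \<hookrightarrow> u) ?bs ?ts"
    using assms(3) by (auto simp: list_all2_conv_all_nth intro: elab_sren[OF assms(1)])
  moreover have "ren Suc (Lam (case_fun bs ts)) = Lam (case_fun ?bs ?ts)"
    by (simp add: ren_case_fun case_fun_map up_ren_up_ren)
  ultimately show ?thesis
    using assms(2) unfolding rec_fun_def
    by (auto intro!: elab.intros simp: case_tree_for_map)
qed

lemma elab_constructor_application:
  assumes "encoding_library L" "surface_context \<Gamma>" "case_tree_for \<Gamma> d bs"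
    and "j < length bs" "length ss = arity (bs ! j)"
    and "L, \<Gamma> \<turnstile> sapps (SCon (ctor (bs ! j))) ss \<hookrightarrow> e"
  obtains us where "list_all2 (elab L \<Gamma>) ss us" "e \<leadsto>\<^sup>* In L \<cdot> con_data (length bs) j us"
proof -
  obtain h us where h: "e = apps h us" "L, \<Gamma> \<turnstile> SCon (ctor (bs ! j)) \<hookrightarrow> h"
    and us: "list_all2 (elab L \<Gamma>) ss us"
    using elab_sappsE[OF assms(6)] .
  have "L, \<Gamma> \<turnstile> SCon (ctor (bs ! j)) \<hookrightarrow> con_tm L (length bs) j (arity (bs ! j))"
    using elab_con[OF assms(3)[unfolded case_tree_for_def], of j] assms(4) by simp
  \<comment> \<open>Inversion leaves the number and position of the constructor open; determinism
    identifies them with those read off from \<open>bs\<close>.\<close>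
  then have "h = con_tm L (length bs) j (arity (bs ! j))"
    using elab_unique[OF assms(2) h(2)] by blast
  moreover have "length us = arity (bs ! j)"
    using us assms(5) by (simp add: list_all2_lengthD)
  ultimately have "e \<leadsto>\<^sup>* In L \<cdot> con_data (length bs) j us"
    using assms(1,4) h(1) by (simp add: con_tm_apps encoding_library_def)
  with us show thesis by (rule that)
qed

text \<open>Inverting a reduction rule yields an index of its own; equal constructor names force it
  to be the given one.\<close>

lemma ctor_nth_inject:
  assumes "surface_context \<Gamma>" "case_tree_for \<Gamma> d bs"
    and "i < length bs" "j < length bs" "ctor (bs ! i) = ctor (bs ! j)"
  shows "i = j"
  using constructor_unique[OF assms(1) assms(2)[unfolded case_tree_for_def] _ _
      assms(2)[unfolded case_tree_for_def], of j "ctor (bs ! j)" _ i] assms(3-5)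
  by simp

section \<open>Joinability for single steps\<close>

lemma mu_step_joinable:
  assumes "encoding_library L" "surface_context \<Gamma>" "case_tree_for \<Gamma> d bs"
    and "j < length bs"
    and "L, \<Gamma> \<turnstile> SMu (sapps (SCon (ctor (bs ! j))) ss) bs \<hookrightarrow> e1"
    and "mu_step (SMu (sapps (SCon (ctor (bs ! j))) ss) bs) t"
    and "L, \<Gamma> \<turnstile> t \<hookrightarrow> e2"
  shows "\<exists>e3. e1 \<leadsto>\<^sup>* e3 \<and> e2 \<leadsto>\<^sup>* e3"
proof -
  have L: "closed (Induction L)" "requirement2 L"
    using assms(1) by (simp_all add: encoding_library_def)
  have ss: "length ss = arity (bs ! j)" and t: "t = ssub (inst (rec_fun bs # ss)) (body (bs ! j))"
    using assms(6) by (auto elim!: mu_step.cases dest!: sapps_SCon_eq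
        dest: ctor_nth_inject[OF assms(2,3,4)])
  from assms(5) obtain s ts where e1: "e1 = mu_tm L \<cdot> s \<cdot> Lam (case_fun bs ts)"
    and s: "L, \<Gamma> \<turnstile> sapps (SCon (ctor (bs ! j))) ss \<hookrightarrow> s"
    and ts: "list_all2 (\<lambda>b u. L, \<Gamma> \<turnstile> body b \<hookrightarrow> u) bs ts"
    by (rule elab_SMuE)
  obtain us where us: "list_all2 (elab L \<Gamma>) ss us" and s': "s \<leadsto>\<^sup>* In L \<cdot> con_data (length bs) j us"
    using elab_constructor_application[OF assms(1-4) ss s] .
  have len: "length us = arity (bs ! j)" "length ts = length bs"
    using us ss ts by (simp_all add: list_all2_lengthD)
  define f where "f = Lam (case_fun bs ts)"
  define xs where "xs = con_data (length bs) j us"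
  \<comment> \<open>Requirement 2 for \<open>a = mu_alg f\<close>: the same \<open>r\<close> is a
    reduct of \<open>Induction L \<cdot> a\<close> and stands for \<open>ih\<close> after unfolding,
    so both sides can reach it.\<close>
  obtain r where r: "Induction L \<cdot> mu_alg f \<leadsto>\<^sup>* r"
      "Induction L \<cdot> mu_alg f \<cdot> (In L \<cdot> xs) \<leadsto>\<^sup>* mu_alg f \<cdot> Out L \<cdot> r \<cdot> xs"
    using L(2) unfolding requirement2_def by meson
  let ?e3 = "sub (inst_lam (r # us)) (ts ! j)"
  \<comment> \<open>The branches after \<open>r\<close> has replaced \<open>ih\<close>, with their
    pattern variables still bound; \<open>inst_lam_Cons\<close> later merges this with the
    instantiation by \<open>us\<close>.\<close>
  let ?ts = "map2 (\<lambda>b t. sub (up (arity b) (case_nat r Var)) t) bs ts"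
  have "e1 \<leadsto>\<^sup>* Induction L \<cdot> mu_alg f \<cdot> s"
    unfolding e1 f_def by (rule mu_tm_apps[OF L(1)])
  also have "\<dots> \<leadsto>\<^sup>* Induction L \<cdot> mu_alg f \<cdot> (In L \<cdot> xs)"
    unfolding xs_def by (rule betaetas_appR[OF s'])
  also note r(2)
  also have "mu_alg f \<cdot> Out L \<cdot> r \<cdot> xs \<leadsto>\<^sup>* f \<cdot> r \<cdot> xs"
    by (rule mu_alg_apps)
  also have "\<dots> \<leadsto>\<^sup>* case_fun bs ?ts \<cdot> xs"
    unfolding f_def by (rule betaetas_appL, rule betaetas_beta) (simp add: sub_case_fun)
  also have "\<dots> \<leadsto>\<^sup>* sub (inst_lam us) (?ts ! j)"
    unfolding xs_def by (rule case_fun_con_data) (use assms(4) len in simp_all)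
  also have "\<dots> = ?e3"
    using assms(4) len by (simp add: inst_lam_Cons flip: len(1))
  finally have e1': "e1 \<leadsto>\<^sup>* ?e3" .
  \<comment> \<open>The elaboration of \<open>rec_fun bs\<close>, hence what the contractum has in
    place of \<open>ih\<close>.\<close>
  define q where "q = Lam (mu_tm L \<cdot> Var 0 \<cdot> ren Suc f)"
  have "list_all2 (elab L \<Gamma>) (rec_fun bs # ss) (q # us)"
    using us elab_rec_fun[OF assms(1,3) ts] by (simp add: q_def f_def)
  then have "L, \<Gamma> \<turnstile> t \<hookrightarrow> sub (inst_lam (q # us)) (ts ! j)"
    unfolding t using ts assms(4)
    by (intro elab_ssub[OF assms(1)] elab_inst) (auto simp: list_all2_conv_all_nth)
  then have e2: "e2 = sub (inst_lam (q # us)) (ts ! j)"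
    using elab_unique[OF assms(2,7)] by blast
  have "q \<leadsto>\<^sup>* r"
    using Lam_mu_tm[OF L(1)] r(1) unfolding q_def by (rule rtranclp_trans)
  then have "e2 \<leadsto>\<^sup>* ?e3"
    \<comment> \<open>The two instantiations differ only at the index \<open>length us\<close> of
      \<open>ih\<close>, where \<open>q\<close> reduces to \<open>r\<close>.\<close>
    unfolding e2 by (intro betaetas_sub) (auto simp: inst_lam_def nth_append nth_Cons split: nat.split)
  with e1' show ?thesis by blast
qed

text \<open>No recursive function is substituted here, so \<open>e2\<close> itself serves as the
  common reduct.\<close>

lemma case_step_joinable:
  assumes "encoding_library L" "surface_context \<Gamma>" "case_tree_for \<Gamma> d bs"
    and "j < length bs"
    and "L, \<Gamma> \<turnstile> SCase (sapps (SCon (ctor (bs ! j))) ss) bs \<hookrightarrow> e1"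
    and "case_step (SCase (sapps (SCon (ctor (bs ! j))) ss) bs) t"
    and "L, \<Gamma> \<turnstile> t \<hookrightarrow> e2"
  shows "e1 \<leadsto>\<^sup>* e2"
proof -
  have ss: "length ss = arity (bs ! j)" and t: "t = ssub (inst ss) (body (bs ! j))"
    using assms(6) by (auto elim!: case_step.cases dest!: sapps_SCon_eq
        dest: ctor_nth_inject[OF assms(2,3,4)])
  from assms(5) obtain s ts where e1: "e1 = case_tm L \<cdot> s \<cdot> case_fun bs ts"
    and s: "L, \<Gamma> \<turnstile> sapps (SCon (ctor (bs ! j))) ss \<hookrightarrow> s"
    and ts: "list_all2 (\<lambda>b u. L, \<Gamma> \<turnstile> body b \<hookrightarrow> u) bs ts"
    by (rule elab_SCaseE)
  obtain us where us: "list_all2 (elab L \<Gamma>) ss us" and s': "s \<leadsto>\<^sup>* In L \<cdot> con_data (length bs) j us"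
    using elab_constructor_application[OF assms(1-4) ss s] .
  have len: "length us = arity (bs ! j)" "length ts = length bs"
    using us ss ts by (simp_all add: list_all2_lengthD)
  have "e1 \<leadsto>\<^sup>* case_fun bs ts \<cdot> (Out L \<cdot> s)"
    unfolding e1 using assms(1) by (intro case_tm_apps) (simp add: encoding_library_def)
  also have "\<dots> \<leadsto>\<^sup>* case_fun bs ts \<cdot> (Out L \<cdot> (In L \<cdot> con_data (length bs) j us))"
    by (intro betaetas_appR s')
  also have "\<dots> \<leadsto>\<^sup>* case_fun bs ts \<cdot> con_data (length bs) j us"
    by (intro betaetas_appR Out_In assms(1))
  also have "\<dots> \<leadsto>\<^sup>* sub (inst_lam us) (ts ! j)"
    by (rule case_fun_con_data[OF len(2) assms(4) len(1)])
  also have "sub (inst_lam us) (ts ! j) = e2"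
  proof (rule elab_unique[OF assms(2) _ assms(7)])
    show "L, \<Gamma> \<turnstile> t \<hookrightarrow> sub (inst_lam us) (ts ! j)"
      unfolding t using ts assms(4) us
      by (intro elab_ssub[OF assms(1)] elab_inst) (auto simp: list_all2_conv_all_nth)
  qed
  finally show ?thesis .
qed

theorem theorem5p2:
  fixes L :: "'d library" and \<Gamma> :: "('d, 'c) sctx" and D :: 'd and bs :: "('d, 'c) case_tree"
  assumes "encoding_library L"
    and "surface_context \<Gamma>"
    and "case_tree_for \<Gamma> D bs"
  shows "(\<forall>j ss e1 t e2.
            j < length bs \<longrightarrow>
            L, \<Gamma> \<turnstile> SMu (sapps (SCon (ctor (bs ! j))) ss) bs \<hookrightarrow> e1 \<longrightarrow>
            mu_step (SMu (sapps (SCon (ctor (bs ! j))) ss) bs) t \<longrightarrow>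
            L, \<Gamma> \<turnstile> t \<hookrightarrow> e2 \<longrightarrow>
            (\<exists>e3. e1 \<leadsto>\<^sup>* e3 \<and> e2 \<leadsto>\<^sup>* e3)) \<and>
         (\<forall>j ss e1 t e2.
            j < length bs \<longrightarrow>
            L, \<Gamma> \<turnstile> SCase (sapps (SCon (ctor (bs ! j))) ss) bs \<hookrightarrow> e1 \<longrightarrow>
            case_step (SCase (sapps (SCon (ctor (bs ! j))) ss) bs) t \<longrightarrow>
            L, \<Gamma> \<turnstile> t \<hookrightarrow> e2 \<longrightarrow>
            (\<exists>e3. e1 \<leadsto>\<^sup>* e3 \<and> e2 \<leadsto>\<^sup>* e3))"
  using mu_step_joinable[OF assms] case_step_joinable[OF assms] by blast

end
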